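(* Let $G$ be a cubic $3$-edge-connected graph. Then $f(G)\leq 7$.
   Context: Graphs are finite and undirected; parallel edges are allowed. A graph is cubic if every vertex has degree $3$; it is $k$-edge-connected if at least $k$ edges leave every nonempty proper vertex subset. An orientation of $G$ replaces each edge $uv$ by exactly one of the arcs $uv$ or $vu$; for an edge $e$, $\vec e$ denotes the corresponding arc. A digraph is strongly connected if for every nonempty proper vertex subset $X$ some arc leaves $X$. For a $3$-edge-connected graph $G$, the Frank number $f(G)$ is the minimum integer $k$ such that there exist $k$ orientations $D_1,\dots,D_k$ of $G$ with the property that for every edge $e$ of $G$ there is an $i$ with $D_i-\vec e$ strongly connected. *)

theory Defs
  imports "Graph_Theory.Digraph_Component" "HOL-Library.Extended_Nat"
begin

text \<open>
  Undirected multigraphs have abstract edges carrying a set of end vertices, so that parallel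
  edges are distinct edges with the same ends.
\<close>

record ('v, 'e) ugraph =
  uverts :: "'v set"
  uedges :: "'e set"
  uends :: "'e \<Rightarrow> 'v set"

text \<open>
  Loops are excluded. For cubic 3-edge-connected graphs this is no restriction: a loop
  at a vertex of degree 3 would leave at most one further edge end at that vertex, so at most
  one edge would leave it; and on a single vertex, loops only produce even degrees.
\<close>

definition finite_multigraph :: "('v, 'e) ugraph \<Rightarrow> bool" where
  "finite_multigraph G \<longleftrightarrow>
     finite (uverts G) \<and> finite (uedges G) \<and>
     (\<forall>e\<in>uedges G. uends G e \<subseteq> uverts G \<and> card (uends G e) = 2)"

definition degree :: "('v, 'e) ugraph \<Rightarrow> 'v \<Rightarrow> nat" where
  "degree G v = card {e \<in> uedges G. v \<in> uends G e}"

definition cubic :: "('v, 'e) ugraph \<Rightarrow> bool" where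
  "cubic G \<longleftrightarrow> (\<forall>v\<in>uverts G. degree G v = 3)"

definition edge_cut :: "('v, 'e) ugraph \<Rightarrow> 'v set \<Rightarrow> 'e set" where
  "edge_cut G X = {e \<in> uedges G. uends G e \<inter> X \<noteq> {} \<and> uends G e - X \<noteq> {}}"

definition k_edge_connected :: "nat \<Rightarrow> ('v, 'e) ugraph \<Rightarrow> bool" where
  "k_edge_connected k G \<longleftrightarrow>
     (\<forall>X. X \<noteq> {} \<and> X \<subset> uverts G \<longrightarrow> k \<le> card (edge_cut G X))"

text \<open>
  An orientation has the edges of \<open>G\<close> themselves as arcs; thus the arc corresponding to an
  edge \<open>e\<close> is \<open>e\<close>, now equipped with a tail and a head.
\<close>

definition orientation :: "('v, 'e) ugraph \<Rightarrow> ('v, 'e) pre_digraph \<Rightarrow> bool" where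
  "orientation G D \<longleftrightarrow>
     verts D = uverts G \<and> arcs D = uedges G \<and>
     (\<forall>e\<in>uedges G. {tail D e, head D e} = uends G e)"

definition frank_orientations ::
  "('v, 'e) ugraph \<Rightarrow> nat \<Rightarrow> (nat \<Rightarrow> ('v, 'e) pre_digraph) \<Rightarrow> bool" where
  "frank_orientations G k D \<longleftrightarrow>
     (\<forall>i<k. orientation G (D i)) \<and>
     (\<forall>e\<in>uedges G. \<exists>i<k. strongly_connected (pre_digraph.del_arc (D i) e))"

text \<open>
  The infimum is taken in \<^typ>\<open>enat\<close>, so it is the minimum whenever some finite family of
  orientations exists and \<open>\<infinity>\<close> otherwise. On \<^typ>\<open>nat\<close>, the infimum of the empty set would be 0.
\<close>

definition frank_number :: "('v, 'e) ugraph \<Rightarrow> enat" where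
  "frank_number G = Inf (enat ` {k. \<exists>D. frank_orientations G k D})"

text \<open>
  The library defines strong connectivity by reachability; it agrees with the definition
  by cuts.
\<close>

lemma (in wf_digraph) strongly_connected_iff_cut:
  assumes "verts G \<noteq> {}"
  shows "strongly_connected G \<longleftrightarrow>
    (\<forall>X. X \<noteq> {} \<and> X \<subset> verts G \<longrightarrow> (\<exists>a\<in>arcs G. tail G a \<in> X \<and> head G a \<notin> X))"
proof (intro iffI allI impI)
  fix X assume sc: "strongly_connected G" and X: "X \<noteq> {} \<and> X \<subset> verts G"
  then obtain u v where uv: "u \<in> X" "v \<in> verts G" "v \<notin> X" by blast
  show "\<exists>a\<in>arcs G. tail G a \<in> X \<and> head G a \<notin> X"
  proof (rule ccontr)
    assume no: "\<not> ?thesis"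
    have "u \<rightarrow>\<^sup>* v" using sc uv X unfolding strongly_connected_def by blast
    then have "v \<in> X"
    proof (induction rule: reachable_induct)
      case base
      then show ?case using uv by simp
    next
      case (step x y)
      then obtain a where "a \<in> arcs G" "tail G a = x" "head G a = y"
        by (auto simp: arcs_ends_def arc_to_ends_def)
      then show ?case using no \<open>x \<in> X\<close> by blast
    qed
    then show False using uv by simp
  qed
next
  assume cut: "\<forall>X. X \<noteq> {} \<and> X \<subset> verts G \<longrightarrow> (\<exists>a\<in>arcs G. tail G a \<in> X \<and> head G a \<notin> X)"
  show "strongly_connected G"
  proof (rule strongly_connectedI)
    show "verts G \<noteq> {}" by fact
  next
    fix u v assume uv: "u \<in> verts G" "v \<in> verts G"
    show "u \<rightarrow>\<^sup>* v"
    proof (rule ccontr)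
      assume nr: "\<not> u \<rightarrow>\<^sup>* v"
      let ?X = "{w. u \<rightarrow>\<^sup>* w}"
      have "u \<in> ?X" using uv by simp
      moreover have "?X \<subset> verts G" using nr uv(2) by (metis (mono_tags, lifting) mem_Collect_eq psubsetI reachable_in_verts(2) subsetI)
      ultimately have "\<exists>a\<in>arcs G. tail G a \<in> ?X \<and> head G a \<notin> ?X"
        using cut[rule_format, of ?X] by (metis (no_types, lifting) empty_iff)
      then obtain a where a: "a \<in> arcs G" "u \<rightarrow>\<^sup>* tail G a" "\<not> u \<rightarrow>\<^sup>* head G a"
        by (elim bexE conjE) simp
      have "tail G a \<rightarrow>\<^bsub>G\<^esub> head G a" using a(1) by (rule in_arcs_imp_in_arcs_ends)
      then show False using a(2,3) reachable_adj_trans by metis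
    qed
  qed
qed

lemma frank_number_le_iff:
  "frank_number G \<le> enat n \<longleftrightarrow> (\<exists>k\<le>n. \<exists>D. frank_orientations G k D)"
proof
  assume le: "frank_number G \<le> enat n"
  let ?S = "enat ` {k. \<exists>D. frank_orientations G k D}"
  have ne: "?S \<noteq> {}"
  proof
    assume "?S = {}"
    then have "frank_number G = \<infinity>" unfolding frank_number_def by (simp add: Inf_enat_def)
    then show False using le by simp
  qed
  then obtain x where "x \<in> ?S" by blast
  then have "Inf ?S \<in> ?S" using ne unfolding Inf_enat_def by (simp only: if_False) (rule LeastI)
  then show "\<exists>k\<le>n. \<exists>D. frank_orientations G k D"
    using le unfolding frank_number_def by auto
next
  assume "\<exists>k\<le>n. \<exists>D. frank_orientations G k D"
  then obtain k where "k \<le> n" "\<exists>D. frank_orientations G k D" by blast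
  then have "frank_number G \<le> enat k"
    unfolding frank_number_def by (intro Inf_lower) auto
  also have "\<dots> \<le> enat n" using \<open>k \<le> n\<close> by simp
  finally show "frank_number G \<le> enat n" .
qed

end

theory Submission
  imports Defs
begin

text \<open>
  Reversing the arcs on which it is negative, a nowhere-zero integer flow yields a strong
  orientation, and every edge of value \<open>\<plusminus>1\<close> may be deleted from it because all cuts have
  at least three edges. By Jaeger's 8-flow theorem there are three integer flows one of which is
  odd at each edge. Take one of the seven nonzero values in \<open>\<int>\<^sub>2\<^sup>3\<close> and change the basis so that this
  value is \<open>(1, 0, 0)\<close>. The three even subgraphs have Eulerian orientations, that is, flows \<open>h1\<close>, \<open>h2\<close>,
  \<open>h3\<close> with values in \<open>{-1, 0, 1}\<close>, and \<open>h1 + 2 h2 + 4 h3\<close> is nowhere zero and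
  equals \<open>\<plusminus>1\<close> at all edges of the chosen class.

  The 8-flow comes from the closure argument in Seymour's proof of the 6-flow theorem: a vertex set
  is enlarged repeatedly by a connected even subgraph (possibly a single vertex) joined to it by at
  least two edges, and off the even subgraphs a \<open>\<int>\<^sub>2 \<times> \<int>\<^sub>2\<close>-flow can be chosen to avoid
  one forbidden value at each edge.
\<close>

section \<open>Boundaries and circulations of integer functions on the edges\<close>

locale multigraph =
  fixes V :: "'v set" and E :: "'e set" and src tgt :: "'e \<Rightarrow> 'v"
  assumes finite_V: "finite V" and finite_E: "finite E"
    and src_V: "e \<in> E \<Longrightarrow> src e \<in> V" and tgt_V: "e \<in> E \<Longrightarrow> tgt e \<in> V"
    and no_loop: "e \<in> E \<Longrightarrow> src e \<noteq> tgt e"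
begin

text \<open>Net outflow with respect to the fixed reference orientation; negative values of
  \<open>f\<close> run against it.\<close>

definition bd :: "('e \<Rightarrow> int) \<Rightarrow> 'v \<Rightarrow> int" where
  "bd f v = (\<Sum>e\<in>E. f e * (of_bool (src e = v) - of_bool (tgt e = v)))"

definition dipole :: "'v \<Rightarrow> 'v \<Rightarrow> 'v \<Rightarrow> int" where
  "dipole u v w = of_bool (u = w) - of_bool (v = w)"

definition induced :: "'v set \<Rightarrow> 'e set" where
  "induced U = {e \<in> E. src e \<in> U \<and> tgt e \<in> U}"

definition between :: "'v set \<Rightarrow> 'v set \<Rightarrow> 'e set" where
  "between A B = {e \<in> E. src e \<in> A \<and> tgt e \<in> B \<or> src e \<in> B \<and> tgt e \<in> A}"

definition supported :: "('e \<Rightarrow> int) \<Rightarrow> 'e set \<Rightarrow> bool" where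
  "supported f F \<longleftrightarrow> (\<forall>e. f e \<noteq> 0 \<longrightarrow> e \<in> F)"

text \<open>Connectivity through edges of \<open>F\<close>, expressed by integer chains instead of
  paths, so that joining, reversing and restricting connections are linear operations.\<close>

definition linked :: "'e set \<Rightarrow> 'v \<Rightarrow> 'v \<Rightarrow> bool" where
  "linked F u v \<longleftrightarrow> (\<exists>p. supported p F \<and> bd p = dipole u v)"

definition circ :: "('e \<Rightarrow> int) \<Rightarrow> bool" where
  "circ f \<longleftrightarrow> bd f = (\<lambda>_. 0)"

lemma bd_add: "bd (\<lambda>e. f e + g e) v = bd f v + bd g v"
  by (simp add: bd_def sum.distrib[symmetric] distrib_right)

lemma bd_scale: "bd (\<lambda>e. k * f e) v = k * bd f v"
  by (simp add: bd_def sum_distrib_left mult.assoc)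

lemma bd_minus: "bd (\<lambda>e. - f e) v = - bd f v"
  using bd_scale[of "-1" f v] by simp

lemma bd_zero: "bd (\<lambda>_. 0) v = 0"
  by (simp add: bd_def)

lemma circ_zero: "circ (\<lambda>_. 0)"
  by (simp add: circ_def bd_zero fun_eq_iff)

lemma circ_add: "circ f \<Longrightarrow> circ g \<Longrightarrow> circ (\<lambda>e. f e + g e)"
  by (simp add: circ_def bd_add fun_eq_iff)

lemma circ_scale: "circ f \<Longrightarrow> circ (\<lambda>e. k * f e)"
  by (simp add: circ_def bd_scale fun_eq_iff)

lemma supported_add: "supported f F \<Longrightarrow> supported g F \<Longrightarrow> supported (\<lambda>e. f e + g e) F"
  unfolding supported_def by (metis add.left_neutral)

lemma supported_scale: "supported f F \<Longrightarrow> supported (\<lambda>e. k * f e) F"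
  by (auto simp: supported_def)

lemma supported_mono: "supported f F \<Longrightarrow> F \<subseteq> F' \<Longrightarrow> supported f F'"
  by (auto simp: supported_def)

lemma supported_zero: "supported (\<lambda>_. 0) F"
  by (simp add: supported_def)

text \<open>Edges with both ends in \<open>X\<close> cancel after exchanging the sums, which leaves
  the net flow out of \<open>X\<close>.\<close>

lemma sum_bd:
  assumes "finite X"
  shows "(\<Sum>v\<in>X. bd f v) = (\<Sum>e\<in>E. f e * (of_bool (src e \<in> X) - of_bool (tgt e \<in> X)))"
proof -
  have "(\<Sum>v\<in>X. bd f v)
      = (\<Sum>e\<in>E. \<Sum>v\<in>X. f e * (of_bool (src e = v) - of_bool (tgt e = v)))"
    unfolding bd_def by (rule sum.swap)
  also have "\<dots> = (\<Sum>e\<in>E. f e * (of_bool (src e \<in> X) - of_bool (tgt e \<in> X)))"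
    using assms by (intro sum.cong refl)
      (simp add: sum_distrib_left[symmetric] sum_subtractf of_bool_def)
  finally show ?thesis .
qed

lemma sum_dipole:
  "finite X \<Longrightarrow> (\<Sum>w\<in>X. dipole u v w) = of_bool (u \<in> X) - of_bool (v \<in> X)"
  by (simp add: dipole_def sum_subtractf of_bool_def)

lemma bd_single:
  assumes "e \<in> E"
  shows "bd (\<lambda>x. if x = e then k else 0) v = k * dipole (src e) (tgt e) v"
proof -
  have "bd (\<lambda>x. if x = e then k else 0) v
      = (\<Sum>x\<in>E. if x = e then k * (of_bool (src x = v) - of_bool (tgt x = v)) else 0)"
    unfolding bd_def by (intro sum.cong) auto
  then show ?thesis using assms finite_E by (simp add: dipole_def)
qed

section \<open>Connectivity by chains\<close>

lemma linked_refl: "linked F v v"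
  unfolding linked_def
  by (intro exI[of _ "\<lambda>_. 0"]) (auto simp: supported_zero bd_zero dipole_def)

lemma linked_sym: "linked F u v \<Longrightarrow> linked F v u"
proof -
  assume "linked F u v"
  then obtain p where "supported p F" "bd p = dipole u v" unfolding linked_def by blast
  then show "linked F v u" unfolding linked_def
    by (intro exI[of _ "\<lambda>e. - p e"]) (auto simp: supported_def bd_minus dipole_def fun_eq_iff)
qed

lemma linked_trans: "linked F u v \<Longrightarrow> linked F v w \<Longrightarrow> linked F u w"
proof -
  assume "linked F u v" "linked F v w"
  then obtain p q where "supported p F" "bd p = dipole u v" "supported q F" "bd q = dipole v w"
    unfolding linked_def by blast
  then show "linked F u w" unfolding linked_def
    by (intro exI[of _ "\<lambda>e. p e + q e"])
      (auto simp: supported_add bd_add dipole_def fun_eq_iff)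
qed

lemma linked_mono: "linked F u v \<Longrightarrow> F \<subseteq> F' \<Longrightarrow> linked F' u v"
  unfolding linked_def using supported_mono by blast

lemma linked_edge: "e \<in> F \<Longrightarrow> e \<in> E \<Longrightarrow> linked F (src e) (tgt e)"
  unfolding linked_def
  by (intro exI[of _ "\<lambda>x. if x = e then 1 else 0"])
    (auto simp: supported_def bd_single fun_eq_iff)

section \<open>Reachability in residual graphs\<close>

text \<open>\<open>A e 1\<close> permits traversing \<open>e\<close> forwards and \<open>A e (-1)\<close> backwards, as in a residual graph.\<close>

definition steps :: "('e \<Rightarrow> int \<Rightarrow> bool) \<Rightarrow> 'v rel" where
  "steps A = {(u, v). \<exists>e\<in>E. A e 1 \<and> src e = u \<and> tgt e = v \<or> A e (-1) \<and> tgt e = u \<and> src e = v}"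

text \<open>A shortest walk uses no edge twice, so its signed edges add up to a chain with
  coefficients 1 and -1 only.\<close>

lemma unit_path:
  assumes "(u, v) \<in> (steps A)\<^sup>*"
  obtains p where "\<And>e. p e \<noteq> 0 \<Longrightarrow> e \<in> E \<and> A e (p e) \<and> p e \<in> {-1, 1}" "bd p = dipole u v"
proof -
  define reach where "reach n z \<longleftrightarrow> (u, z) \<in> steps A ^^ n" for n z
  \<comment> \<open>The induction also records that both ends of every used edge are reached within
    \<open>n\<close> steps; this shows that the next edge is new.\<close>
  have claim: "\<exists>p. (\<forall>e. p e \<noteq> 0 \<longrightarrow> e \<in> E \<and> A e (p e) \<and> p e \<in> {-1, 1}
        \<and> (\<exists>m\<le>n. reach m (src e)) \<and> (\<exists>m\<le>n. reach m (tgt e))) \<and> bd p = dipole u v"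
    if "reach n v" "\<And>m. m < n \<Longrightarrow> \<not> reach m v" for n v
    using that
  proof (induction n arbitrary: v)
    case 0
    then have "u = v" by (simp add: reach_def)
    then show ?case by (intro exI[of _ "\<lambda>_. 0"]) (auto simp: bd_zero dipole_def)
  next
    case (Suc n)
    from Suc.prems(1) obtain w where w: "reach n w" "(w, v) \<in> steps A"
      by (auto simp: reach_def)
    have "\<not> reach m w" if "m < n" for m
    proof
      assume "reach m w"
      then have "reach (Suc m) v" using w(2) by (auto simp: reach_def)
      then show False using Suc.prems(2)[of "Suc m"] that by simp
    qed
    with Suc.IH[OF w(1)] obtain p where p:
      "\<forall>e. p e \<noteq> 0 \<longrightarrow> e \<in> E \<and> A e (p e) \<and> p e \<in> {-1, 1}
        \<and> (\<exists>m\<le>n. reach m (src e)) \<and> (\<exists>m\<le>n. reach m (tgt e))" "bd p = dipole u w"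
      by blast
    have unreached: "\<not> reach m v" if "m \<le> n" for m using Suc.prems(2)[of m] that by simp
    from w(2) obtain e k where e: "e \<in> E" "A e k" "k \<in> {-1, 1}"
      "k = 1 \<and> src e = w \<and> tgt e = v \<or> k = -1 \<and> tgt e = w \<and> src e = v"
      by (auto simp: steps_def)
    \<comment> \<open>One end of \<open>e\<close> is \<open>v\<close>, which is not reached within
      \<open>n\<close> steps.\<close>
    have pe: "p e = 0" using p(1) e(4) unreached by metis
    let ?q = "\<lambda>x. p x + (if x = e then k else 0)"
    have "bd ?q = dipole u v"
      using e(4) by (auto simp: bd_add bd_single[OF e(1)] p(2) fun_eq_iff dipole_def)
    moreover have "\<forall>x. ?q x \<noteq> 0 \<longrightarrow> x \<in> E \<and> A x (?q x) \<and> ?q x \<in> {-1, 1}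
        \<and> (\<exists>m\<le>Suc n. reach m (src x)) \<and> (\<exists>m\<le>Suc n. reach m (tgt x))"
    proof (intro allI impI)
      fix x assume x: "?q x \<noteq> 0"
      show "x \<in> E \<and> A x (?q x) \<and> ?q x \<in> {-1, 1}
        \<and> (\<exists>m\<le>Suc n. reach m (src x)) \<and> (\<exists>m\<le>Suc n. reach m (tgt x))"
      proof (cases "x = e")
        case True
        then show ?thesis using e pe w(1) Suc.prems(1) le_SucI[OF le_refl, of n]
            by (auto intro: exI[of _ n] exI[of _ "Suc n"])
      next
        case False
        then have "p x \<noteq> 0" "?q x = p x" using x by simp_all
          then show ?thesis using p(1)[rule_format, of x] by (auto intro: le_SucI)
      qed
    qed
    ultimately show ?case by (intro exI[of _ ?q] conjI)
  qed
  from assms obtain n0 where "reach n0 v" unfolding reach_def by (meson rtrancl_imp_relpow)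
  then have "reach (LEAST n. reach n v) v" "\<And>m. m < (LEAST n. reach n v) \<Longrightarrow> \<not> reach m v"
    by (auto intro: LeastI dest: not_less_Least)
  from claim[OF this] show ?thesis using that by blast
qed

lemma reach_closed:
  assumes "e \<in> E" "R = {w. (v, w) \<in> (steps A)\<^sup>*}"
  shows "src e \<in> R \<Longrightarrow> A e 1 \<Longrightarrow> tgt e \<in> R" "tgt e \<in> R \<Longrightarrow> A e (-1) \<Longrightarrow> src e \<in> R"
proof -
  show "tgt e \<in> R" if "src e \<in> R" "A e 1"
  proof -
    have "(src e, tgt e) \<in> steps A" using that assms(1) by (auto simp: steps_def)
    then show ?thesis using that(1) by (auto simp: assms(2) intro: rtrancl_into_rtrancl)
  qed
  show "src e \<in> R" if "tgt e \<in> R" "A e (-1)"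
  proof -
    have "(tgt e, src e) \<in> steps A" using that assms(1) by (auto simp: steps_def)
    then show ?thesis using that(1) by (auto simp: assms(2) intro: rtrancl_into_rtrancl)
  qed
qed

lemma reach_subset:
  assumes "v \<in> S" and "\<And>e k. e \<in> E \<Longrightarrow> A e k \<Longrightarrow> src e \<in> S \<and> tgt e \<in> S"
  shows "{w. (v, w) \<in> (steps A)\<^sup>*} \<subseteq> S"
proof (intro subsetI, elim CollectE)
  fix w assume "(v, w) \<in> (steps A)\<^sup>*"
  then show "w \<in> S"
    by (cases rule: rtranclE) (use assms in \<open>auto simp: steps_def\<close>)
qed

section \<open>Eulerian orientations of even subgraphs\<close>

text \<open>Among all choices of signs on the odd edges of \<open>f\<close>, one with least total
  imbalance is balanced: otherwise, reversing a directed path from a vertex with surplus to one with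
  deficit would lower the imbalance.\<close>

lemma eulerian_lift:
  assumes "circ f"
  obtains h where "circ h" "\<And>e. e \<in> E \<Longrightarrow> h e \<in> {-1, 0, 1}"
    "\<And>e. e \<in> E \<Longrightarrow> odd (h e) \<longleftrightarrow> odd (f e)"
proof -
  define ok where "ok h \<longleftrightarrow> (\<forall>e\<in>E. h e \<in> {-1, 0, 1} \<and> (odd (h e) \<longleftrightarrow> odd (f e)))"
    for h :: "'e \<Rightarrow> int"
  define \<mu> where "\<mu> h = nat (\<Sum>v\<in>V. \<bar>bd h v\<bar>)" for h
  have "ok (\<lambda>e. if odd (f e) then 1 else 0)" by (auto simp: ok_def)
  from ex_has_least_nat[of ok, OF this, of \<mu>] have "\<exists>h. ok h \<and> (\<forall>h'. ok h' \<longrightarrow> \<mu> h \<le> \<mu> h')" .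
  then obtain h where h: "ok h" and min: "\<And>h'. ok h' \<Longrightarrow> \<mu> h \<le> \<mu> h'" by blast
  have outside: "bd g v = 0" if "v \<notin> V" for g v
    using that src_V tgt_V by (auto simp: bd_def intro!: sum.neutral)
  \<comment> \<open>A nonzero imbalance is thus at least 2 in absolute value, and the shift by 2
    made below cannot overshoot.\<close>
  have even: "even (bd h v)" for v
  proof -
    have "even (bd h v - bd f v)"
      unfolding bd_def sum_subtractf[symmetric]
      using h by (intro dvd_sum) (auto simp: ok_def left_diff_distrib[symmetric])
    then show ?thesis using assms by (simp add: circ_def)
  qed
  have "bd h v = 0" for v
  proof (rule ccontr)
    assume nz: "bd h v \<noteq> 0"
    have "(\<Sum>v\<in>V. bd h v) = 0"
      unfolding sum_bd[OF finite_V] using src_V tgt_V by (intro sum.neutral) auto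
    then have "\<exists>v\<in>V. bd h v > 0"
      using nz outside[of v h] sum_nonneg_eq_0_iff[OF finite_V, of "\<lambda>v. - bd h v"]
      by (force simp: sum_negf linorder_not_less)
    then obtain v where v: "v \<in> V" "bd h v > 0" by blast
    \<comment> \<open>Edges may be followed only in their direction under \<open>h\<close>, so paths
      are directed paths.\<close>
    define A where "A = (\<lambda>e k. h e = (k::int))"
    define R where "R = {w. (v, w) \<in> (steps A)\<^sup>*}"
    have "R \<subseteq> V"
      unfolding R_def using v(1) src_V tgt_V by (intro reach_subset) auto
    then have fin: "finite R" using finite_V finite_subset by blast
    \<comment> \<open>No arc of \<open>h\<close> leaves \<open>R\<close>, so the surplus at
      \<open>v\<close> forces a deficit somewhere in \<open>R\<close>.\<close>
    have "h e * (of_bool (src e \<in> R) - of_bool (tgt e \<in> R)) \<le> 0" if "e \<in> E" for e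
      using reach_closed[OF that R_def] h that by (auto simp: ok_def A_def)
    then have "(\<Sum>w\<in>R. bd h w) \<le> 0" unfolding sum_bd[OF fin] by (intro sum_nonpos)
    moreover have "v \<in> R" by (simp add: R_def)
    ultimately have "\<exists>w\<in>R. bd h w < 0"
      using sum_pos2[OF fin, of v "bd h"] v(2) by (meson linorder_not_less)
    then obtain u where u: "u \<in> R" "bd h u < 0" by blast
    obtain p where p: "\<And>e. p e \<noteq> 0 \<Longrightarrow> e \<in> E \<and> A e (p e) \<and> p e \<in> {-1, 1}" "bd p = dipole v u"
      using unit_path[of v u A] u(1) by (auto simp: R_def)
    \<comment> \<open>Where \<open>p\<close> is nonzero it equals \<open>h\<close>, so exactly the
      arcs of the path are reversed and all parities are kept.\<close>
    define h' where "h' = (\<lambda>e. h e + (-2) * p e)"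
    have "ok h'"
      unfolding ok_def
    proof
      fix e assume e: "e \<in> E"
      show "h' e \<in> {- 1, 0, 1} \<and> odd (h' e) = odd (f e)"
      proof (cases "p e = 0")
        case True
        then show ?thesis using h e by (simp add: h'_def ok_def)
      next
        case False
        then have "h' e = - h e" using p(1)[of e] by (simp add: h'_def A_def)
        then show ?thesis using h e by (auto simp: ok_def)
      qed
    qed
    have bd': "bd h' w = bd h w - 2 * dipole v u w" for w
      by (simp add: h'_def bd_add bd_scale p(2) del: mult_minus_left)
    have ge: "bd h v \<ge> 2" "bd h u \<le> -2"
      using even[of v] even[of u] u(2) v(2) by presburger+
    have "u \<noteq> v" using ge by auto
    then have "\<bar>bd h' v\<bar> < \<bar>bd h v\<bar>" using ge by (simp add: bd' dipole_def)
    moreover have "\<bar>bd h' w\<bar> \<le> \<bar>bd h w\<bar>" for w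
      using ge \<open>u \<noteq> v\<close> by (cases "w = u"; cases "w = v") (simp_all add: bd' dipole_def)
    ultimately have "(\<Sum>w\<in>V. \<bar>bd h' w\<bar>) < (\<Sum>w\<in>V. \<bar>bd h w\<bar>)"
      using v(1) by (intro sum_strict_mono_ex1 finite_V) auto
    moreover have "0 \<le> (\<Sum>w\<in>V. \<bar>bd h' w\<bar>)" by (simp add: sum_nonneg)
    ultimately have "\<mu> h' < \<mu> h" unfolding \<mu>_def by linarith
    then show False using min[OF \<open>ok h'\<close>] by simp
  qed
  then show ?thesis using that[of h] h by (auto simp: circ_def ok_def)
qed

section \<open>Connected even subgraphs through two vertices\<close>

text \<open>No edge of the support crosses the border of \<open>X\<close>, so each vertex keeps all
  of its boundary or none. This cuts chains down to a component of \<open>D\<close>.\<close>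

lemma bd_restrict:
  assumes "supported g D" "\<And>e. e \<in> D \<Longrightarrow> src e \<in> X \<longleftrightarrow> tgt e \<in> X"
  shows "bd (\<lambda>e. if e \<in> induced X then g e else 0) v = of_bool (v \<in> X) * bd g v"
  unfolding bd_def sum_distrib_left
proof (rule sum.cong[OF refl])
  fix e assume "e \<in> E"
  then show "(if e \<in> induced X then g e else 0) * (of_bool (src e = v) - of_bool (tgt e = v)) =
    of_bool (v \<in> X) * (g e * (of_bool (src e = v) - of_bool (tgt e = v)))"
    using assms by (cases "g e = 0") (auto simp: supported_def induced_def)
qed

text \<open>Two edge-disjoint paths from \<open>x\<close> to \<open>y\<close> arise by one
  augmentation, as in the flow proof of Menger's theorem; the component of \<open>x\<close> in their
  edge set is the even subgraph. For \<open>x = y\<close> the cut condition is vacuous.\<close>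

lemma eulerian_through_two:
  assumes "W \<subseteq> V" "x \<in> W" "y \<in> W"
    and cut: "\<And>Z. Z \<subseteq> W \<Longrightarrow> x \<in> Z \<Longrightarrow> y \<notin> Z \<Longrightarrow> 2 \<le> card (between Z (W - Z))"
  obtains X d where "X \<subseteq> W" "x \<in> X" "y \<in> X" "circ d" "supported d (induced X)"
    "\<forall>v\<in>X. linked {e \<in> induced X. odd (d e)} x v"
proof -
  have inE: "e \<in> E" if "e \<in> induced U" for e U using that by (simp add: induced_def)
  have fin: "finite Z" if "Z \<subseteq> W" for Z using that assms(1) finite_V by (meson finite_subset)
  define A where "A = (\<lambda>e (k::int). e \<in> induced W)"
  define R where "R = {w. (x, w) \<in> (steps A)\<^sup>*}"
  have RW: "R \<subseteq> W"
    unfolding R_def using assms(2) by (intro reach_subset) (auto simp: A_def induced_def)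
  have "y \<in> R"
  proof (rule ccontr)
    assume "y \<notin> R"
    then have "between R (W - R) \<noteq> {}" using cut[OF RW] by (auto simp: R_def)
    then obtain e where "e \<in> between R (W - R)" by blast
    then show False using reach_closed[of e, OF _ R_def] RW
      by (auto simp: between_def A_def induced_def)
  qed
  then obtain p where p: "\<And>e. p e \<noteq> 0 \<Longrightarrow> e \<in> E \<and> A e (p e) \<and> p e \<in> {-1, 1}" "bd p = dipole x y"
    using unit_path[of x y A] by (auto simp: R_def)
  \<comment> \<open>The residual graph of the unit flow \<open>p\<close>: an edge may not be
    followed again in the direction in which \<open>p\<close> uses it.\<close>
  define B where "B = (\<lambda>e k. e \<in> induced W \<and> p e \<noteq> k)"
  define R' where "R' = {w. (x, w) \<in> (steps B)\<^sup>*}"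
  have RW': "R' \<subseteq> W"
    unfolding R'_def using assms(2) by (intro reach_subset) (auto simp: B_def induced_def)
  have "y \<in> R'"
  proof (rule ccontr)
    assume y: "y \<notin> R'"
    have x: "x \<in> R'" by (simp add: R'_def)
    \<comment> \<open>Every edge between \<open>R'\<close> and the rest of \<open>W\<close> is
      saturated outwards by \<open>p\<close>, so there are only as many as the flow value 1.\<close>
    have "of_bool (e \<in> between R' (W - R')) = p e * (of_bool (src e \<in> R') - of_bool (tgt e \<in> R'))"
      if e: "e \<in> E" for e
    proof (cases "e \<in> induced W")
      case True
      then show ?thesis using reach_closed[OF e R'_def] e
        by (auto simp: between_def B_def induced_def)
    next
      case False
      then have "p e = 0" using p(1)[of e] by (auto simp: A_def)
      then show ?thesis using False e RW' by (auto simp: between_def induced_def)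
    qed
    then have "(\<Sum>e\<in>E. of_bool (e \<in> between R' (W - R'))) = (\<Sum>w\<in>R'. bd p w)"
      unfolding sum_bd[OF fin[OF RW']] by (intro sum.cong) auto
    also have "\<dots> = 1" using x y by (simp add: p(2) sum_dipole[OF fin[OF RW']])
    finally have "int (card (between R' (W - R'))) = 1"
      using finite_E by (simp add: of_bool_def sum.If_cases Int_def between_def conj_commute)
    then show False using cut[OF RW' x y] by simp
  qed
  then obtain q where q: "\<And>e. q e \<noteq> 0 \<Longrightarrow> e \<in> E \<and> B e (q e) \<and> q e \<in> {-1, 1}" "bd q = dipole x y"
    using unit_path[of x y B] by (auto simp: R'_def)
  \<comment> \<open>By the choice of \<open>B\<close>, \<open>p\<close> and \<open>q\<close> cancel
    on every edge that both use; hence \<open>r\<close> is odd wherever it is nonzero.\<close>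
  define r where "r = (\<lambda>e. p e + q e)"
  define D where "D = {e \<in> induced W. odd (r e)}"
  have r: "supported r D"
    unfolding supported_def
  proof (intro allI impI)
    fix e assume "r e \<noteq> 0"
    then show "e \<in> D" using p(1)[of e] q(1)[of e]
      by (cases "p e = 0"; cases "q e = 0") (auto simp: r_def D_def A_def B_def)
  qed
  have bdr: "bd r w = 2 * dipole x y w" for w by (simp add: r_def bd_add p(2) q(2))
  define X where "X = {v \<in> W. linked D x v}"
  have XW: "X \<subseteq> W" by (auto simp: X_def)
  have closed: "src e \<in> X \<longleftrightarrow> tgt e \<in> X" if "e \<in> D" for e
  proof -
    have "linked D (src e) (tgt e)" using that inE by (intro linked_edge) (auto simp: D_def)
    then show ?thesis using that linked_trans[of D x] linked_sym[of D "src e" "tgt e"]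
      by (auto simp: X_def D_def induced_def)
  qed
  have xX: "x \<in> X" using assms(2) linked_refl by (simp add: X_def)
  \<comment> \<open>The component \<open>X\<close> has no edge of \<open>D\<close> leaving it;
    without \<open>y\<close> its total boundary would be 2.\<close>
  have "(\<Sum>w\<in>X. bd r w) = 0"
    unfolding sum_bd[OF fin[OF XW]]
  proof (intro sum.neutral ballI)
    fix e
    show "r e * (of_bool (src e \<in> X) - of_bool (tgt e \<in> X)) = 0"
      using r closed[of e] by (cases "r e = 0") (auto simp: supported_def)
  qed
  then have yX: "y \<in> X"
    using xX by (simp add: bdr sum_distrib_left[symmetric] sum_dipole[OF fin[OF XW]])
  then obtain \<pi> where \<pi>: "supported \<pi> D" "bd \<pi> = dipole x y"
    by (auto simp: X_def linked_def)
  \<comment> \<open>Subtracting twice a chain in \<open>D\<close> removes the boundary without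
    changing any parity.\<close>
  define c where "c = (\<lambda>e. r e + (-2) * \<pi> e)"
  have c: "supported c D" "bd c w = 0" for w
    using supported_add[OF r supported_scale[OF \<pi>(1)]]
    by (simp_all add: c_def bd_add bd_scale bdr \<pi>(2) del: mult_minus_left)
  define d where "d = (\<lambda>e. if e \<in> induced X then c e else 0)"
  have "circ d"
    using bd_restrict[OF c(1) closed] c(2) by (simp add: circ_def d_def fun_eq_iff)
  moreover have "supported d (induced X)" by (simp add: supported_def d_def)
  moreover have "linked {e \<in> induced X. odd (d e)} x v" if v: "v \<in> X" for v
  proof -
    obtain p' where p': "supported p' D" "bd p' = dipole x v"
      using v by (auto simp: X_def linked_def)
    have "bd (\<lambda>e. if e \<in> induced X then p' e else 0) w = dipole x v w" for w
      using v xX by (auto simp: bd_restrict[OF p'(1) closed] p'(2) dipole_def)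
    moreover have "supported (\<lambda>e. if e \<in> induced X then p' e else 0) {e \<in> induced X. odd (d e)}"
      using p'(1) by (auto simp: supported_def d_def c_def D_def)
    ultimately show ?thesis unfolding linked_def by blast
  qed
  ultimately show ?thesis using that[OF XW xX yX] by blast
qed

section \<open>Seymour's closure argument and the 8-flow\<close>

lemma card_between_Un:
  assumes "A \<inter> B = {}" "A \<inter> C = {}" "B \<inter> C = {}"
  shows "card (between A (B \<union> C)) = card (between A B) + card (between A C)"
proof -
  have "between A (B \<union> C) = between A B \<union> between A C" by (auto simp: between_def)
  moreover have "between A B \<inter> between A C = {}" using assms by (auto simp: between_def)
  ultimately show ?thesis using finite_E by (simp add: card_Un_disjoint between_def)
qed

lemma between_commute: "between A B = between B A"
  by (auto simp: between_def)

text \<open>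
  The last conjunct is group connectivity over \<open>\<int>\<^sub>2 \<times> \<int>\<^sub>2\<close> of the graph obtained by contracting
  the even subgraph: the forbidden values are arbitrary, which is what makes the induction work.
\<close>

definition seymour_base :: "'v set \<Rightarrow> ('e \<Rightarrow> int) \<Rightarrow> bool" where
  "seymour_base U c \<longleftrightarrow> U \<subseteq> V \<and> (\<forall>u\<in>U. \<forall>v\<in>U. linked (induced U) u v)
    \<and> circ c \<and> supported c (induced U)
    \<and> (\<forall>a b. \<exists>f g. circ f \<and> circ g \<and> supported f (induced U) \<and> supported g (induced U)
          \<and> (\<forall>e\<in>induced U. even (c e) \<longrightarrow> odd (a e + f e) \<or> odd (b e + g e)))"

lemma seymour_base_singleton: "v \<in> V \<Longrightarrow> seymour_base {v} (\<lambda>_. 0)"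
proof -
  assume "v \<in> V"
  moreover have "induced {v} = {}" using no_loop by (fastforce simp: induced_def)
  ultimately show ?thesis
    using linked_refl circ_zero supported_zero[of "{}"] by (auto simp: seymour_base_def)
qed

text \<open>A fundamental circuit with respect to \<open>F\<close>: it changes the value at
  \<open>e\<close> and at no other edge outside \<open>F\<close>.\<close>

lemma circuit_through:
  assumes "e \<in> E" "e \<notin> F" "linked F (src e) (tgt e)"
  obtains p where "circ p" "supported p (insert e F)" "p e = 1"
proof -
  obtain q where q: "supported q F" "bd q = dipole (tgt e) (src e)"
    using linked_sym[OF assms(3)] by (auto simp: linked_def)
  let ?p = "\<lambda>x. q x + (if x = e then 1 else 0)"
  have "circ ?p"
    by (auto simp: circ_def bd_add q(2) bd_single[OF assms(1)] dipole_def fun_eq_iff)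
  moreover have "supported ?p (insert e F)" "?p e = 1"
    using q(1) assms(2) by (auto simp: supported_def)
  ultimately show ?thesis using that by blast
qed

text \<open>Two edges exclude at most two of the four coefficients in \<open>\<int>\<^sub>2 \<times> \<int>\<^sub>2\<close>.\<close>

lemma avoid_two:
  assumes "odd (r1::int)" "odd r2"
  shows "\<exists>i j. (odd (a1 + i * r1) \<or> odd (b1 + j * r1)) \<and> (odd (a2 + i * r2) \<or> odd (b2 + j * r2))"
proof -
  have "\<exists>i\<in>{0,1::int}. \<exists>j\<in>{0,1::int}.
    (odd (a1 + i) \<or> odd (b1 + j)) \<and> (odd (a2 + i) \<or> odd (b2 + j))" by auto
  then show ?thesis using assms by (metis even_add even_mult_iff)
qed

text \<open>The forbidden values are avoided in three rounds: first at the edges outside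
  \<open>F\<close> other than \<open>e2\<close>, by fundamental circuits; then at \<open>e1\<close>
  and \<open>e2\<close> together, by one circuit through both; finally inside \<open>U\<close>, by
  \<open>base\<close>. No round disturbs the edges settled before.\<close>

lemma seymour_base_extend:
  assumes base: "seymour_base U c" and X: "X \<subseteq> V - U"
    and ends: "e1 \<in> between X U" "e2 \<in> between X U" "e1 \<noteq> e2"
    and d: "circ d" "supported d (induced X)"
    and conn: "\<And>u v. u \<in> X \<Longrightarrow> v \<in> X \<Longrightarrow> linked {e \<in> induced X. odd (d e)} u v"
  shows "seymour_base (U \<union> X) (\<lambda>e. c e + d e)"
proof -
  define D where "D = {e \<in> induced X. odd (d e)}"
  define I where "I = induced (U \<union> X)"
  \<comment> \<open>\<open>F\<close> connects all of \<open>U \<union> X\<close>, with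
    \<open>e1\<close> as the only edge joining the two parts; so the circuit of \<open>e2\<close>
    must pass through \<open>e1\<close>.\<close>
  define F where "F = insert e1 (induced U \<union> D)"
  have c: "U \<subseteq> V" "\<And>u v. u \<in> U \<Longrightarrow> v \<in> U \<Longrightarrow> linked (induced U) u v"
    "circ c" "supported c (induced U)"
    using base by (auto simp: seymour_base_def)
  have sub: "induced U \<subseteq> I" "induced X \<subseteq> I" "D \<subseteq> I" "F \<subseteq> I" "e1 \<in> I" "e2 \<in> I" "D \<subseteq> F"
    "induced U \<subseteq> F"
    using ends by (auto simp: I_def D_def F_def induced_def between_def)
  have disj: "induced U \<inter> induced X = {}" using X by (auto simp: induced_def)
  have ein: "e1 \<in> E" "e2 \<in> E" "e1 \<notin> induced U \<union> D" "e2 \<notin> F"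
    using ends X by (auto simp: between_def F_def D_def induced_def)
  obtain x u where xu: "x \<in> X" "u \<in> U" "linked F x u"
    using ends(1) linked_edge[of e1 F] linked_sym[of F "src e1" "tgt e1"]
    by (auto simp: between_def F_def)
  have to_x: "linked F z x" if "z \<in> U \<union> X" for z
  proof (cases "z \<in> X")
    case True
    then show ?thesis using conn[OF True xu(1)] linked_mono sub(7) by (auto simp: D_def)
  next
    case False
    then have "linked F z u" using that c(2)[of z u] xu(2) linked_mono sub(8) by blast
    then show ?thesis using linked_trans linked_sym xu(3) by blast
  qed
  have linkF: "linked F z w" if "z \<in> U \<union> X" "w \<in> U \<union> X" for z w
    using to_x that linked_trans linked_sym by blast
  have circuit: "\<exists>p. circ p \<and> supported p (insert e F) \<and> p e = 1" if "e \<in> I - F" for e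
  proof -
    have "e \<in> E" "e \<notin> F" "src e \<in> U \<union> X" "tgt e \<in> U \<union> X"
      using that by (auto simp: I_def induced_def)
    then show ?thesis using circuit_through[of e F] linkF by blast
  qed
  obtain r where r: "circ r" "supported r (insert e2 F)" "r e2 = 1" using circuit[of e2] sub ein by blast
  \<comment> \<open>Only \<open>e1\<close> and \<open>e2\<close> carry \<open>r\<close> across the
    border of \<open>X\<close>, so the two values agree up to sign.\<close>
  have odd_r: "odd (r e1)"
  proof -
    have "finite X" using X finite_V by (meson finite_Diff finite_subset)
    from sum_bd[OF this, of r]
    have "0 = (\<Sum>e\<in>E. r e * (of_bool (src e \<in> X) - of_bool (tgt e \<in> X)))"
      using r(1) by (simp add: circ_def)
    also have "\<dots> = (\<Sum>e\<in>{e1, e2}. r e * (of_bool (src e \<in> X) - of_bool (tgt e \<in> X)))"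
    proof (intro sum.mono_neutral_right finite_E ballI)
      show "{e1, e2} \<subseteq> E" using ein by simp
      fix e assume "e \<in> E - {e1, e2}"
      then show "r e * (of_bool (src e \<in> X) - of_bool (tgt e \<in> X)) = 0"
        using r(2) X by (auto simp: supported_def F_def D_def induced_def)
    qed
    finally have "0 = (\<Sum>e\<in>{e1, e2}. r e * (of_bool (src e \<in> X) - of_bool (tgt e \<in> X)))" .
    moreover have "(src e1 \<in> X) \<noteq> (tgt e1 \<in> X)" "(src e2 \<in> X) \<noteq> (tgt e2 \<in> X)"
      using ends X unfolding between_def by blast+
    ultimately have "r e1 = 1 \<or> r e1 = -1"
      using ends(3) r(3) by (cases "src e1 \<in> X"; cases "src e2 \<in> X") auto
    then show ?thesis by auto
  qed
  show ?thesis
    unfolding seymour_base_def I_def[symmetric]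
  proof (intro conjI allI ballI)
    show "U \<union> X \<subseteq> V" using c X by blast
    show "linked I z w" if "z \<in> U \<union> X" "w \<in> U \<union> X" for z w
      using linkF[OF that] linked_mono sub by blast
    show "circ (\<lambda>e. c e + d e)" using c d circ_add by blast
    show "supported (\<lambda>e. c e + d e) I"
      using c(4) d(2) sub supported_add supported_mono by blast
  next
    fix a b :: "'e \<Rightarrow> int"
    \<comment> \<open>The circuit of a further edge vanishes on the edges of \<open>S\<close>
      treated before. Making the first coordinate odd suffices, so only \<open>f\<close> is
      modified.\<close>
    have avoid: "\<exists>f g. circ f \<and> circ g \<and> supported f (F \<union> S) \<and> supported g (F \<union> S)
      \<and> (\<forall>e\<in>S. odd (a e + f e) \<or> odd (b e + g e))"
      if "finite S" "S \<subseteq> I - F - {e2}" for S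
      using that
    proof (induction S rule: finite_induct)
      case empty
      then show ?case using circ_zero supported_zero by auto
    next
      case (insert e S)
      then obtain f g where fg: "circ f" "circ g" "supported f (F \<union> S)" "supported g (F \<union> S)"
        "\<forall>e\<in>S. odd (a e + f e) \<or> odd (b e + g e)" by auto
      obtain p where p: "circ p" "supported p (insert e F)" "p e = 1" using circuit insert by blast
      have z: "p y = 0" if "y \<in> S" for y
        using p(2) that insert by (auto simp: supported_def)
      define f' where "f' = (if odd (a e + f e) then f else (\<lambda>x. f x + p x))"
      have "supported f (F \<union> insert e S)" "supported p (F \<union> insert e S)"
        "supported g (F \<union> insert e S)"
        using fg(3,4) p(2) by (auto elim!: supported_mono)
      moreover have "\<forall>y\<in>insert e S. odd (a y + f' y) \<or> odd (b y + g y)"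
        using fg(5) p(3) z by (auto simp: f'_def)
      moreover have "circ f'" using circ_add[OF fg(1) p(1)] fg(1) by (simp add: f'_def)
      moreover have "supported f' (F \<union> insert e S)"
        using supported_add[OF calculation(1,2)] calculation(1) by (simp add: f'_def)
      ultimately show ?case using fg(2) by (intro exI[of _ f'] exI[of _ g]) simp
    qed
    have "finite (I - F - {e2})" using finite_E by (simp add: I_def induced_def)
    from avoid[OF this order_refl] obtain f1 g1 where 1: "circ f1" "circ g1"
      "supported f1 (F \<union> (I - F - {e2}))" "supported g1 (F \<union> (I - F - {e2}))"
      "\<And>e. e \<in> I - F - {e2} \<Longrightarrow> odd (a e + f1 e) \<or> odd (b e + g1 e)"
      by blast
    have supp1: "supported f1 I" "supported g1 I"
      using 1(3,4) sub(4) by (auto elim!: supported_mono)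
    obtain i j where ij:
      "odd (a e1 + f1 e1 + i * r e1) \<or> odd (b e1 + g1 e1 + j * r e1)"
      "odd (a e2 + f1 e2 + i * r e2) \<or> odd (b e2 + g1 e2 + j * r e2)"
      using avoid_two[OF odd_r, of "r e2"] r(3) by (metis odd_one)
    \<comment> \<open>What has been chosen so far is absorbed into the forbidden values, which are
      arbitrary in \<open>base\<close>.\<close>
    define a' where "a' = (\<lambda>e. a e + f1 e + i * r e)"
    define b' where "b' = (\<lambda>e. b e + g1 e + j * r e)"
    obtain f2 g2 where 2: "circ f2" "circ g2" "supported f2 (induced U)" "supported g2 (induced U)"
      "\<And>e. e \<in> induced U \<Longrightarrow> even (c e) \<Longrightarrow> odd (a' e + f2 e) \<or> odd (b' e + g2 e)"
      using base unfolding seymour_base_def by metis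
    define f where "f = (\<lambda>e. f1 e + (i * r e + f2 e))"
    define g where "g = (\<lambda>e. g1 e + (j * r e + g2 e))"
    have ri: "supported r I" using r(2) sub by (auto elim!: supported_mono)
    have "circ f" "circ g"
      unfolding f_def g_def
      by (rule circ_add[OF 1(1) circ_add[OF circ_scale[OF r(1)] 2(1)]])
        (rule circ_add[OF 1(2) circ_add[OF circ_scale[OF r(1)] 2(2)]])
    moreover have "supported f I" "supported g I"
      unfolding f_def g_def
      by (rule supported_add[OF supp1(1)
            supported_add[OF supported_scale[OF ri] supported_mono[OF 2(3) sub(1)]]])
        (rule supported_add[OF supp1(2)
            supported_add[OF supported_scale[OF ri] supported_mono[OF 2(4) sub(1)]]])
    moreover have "odd (a e + f e) \<or> odd (b e + g e)" if e: "e \<in> I" "even (c e + d e)" for e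
    proof (cases "e \<in> induced U")
      case True
      then have "d e = 0" using d(2) disj by (auto simp: supported_def)
      then show ?thesis using 2(5)[OF True] e(2) by (simp add: f_def g_def a'_def b'_def add.assoc)
    next
      case False
      then have 0: "c e = 0" "f2 e = 0" "g2 e = 0"
        using c(4) 2(3,4) by (auto simp: supported_def)
      then have "e \<notin> D" using e(2) by (auto simp: D_def)
      then consider "e = e1" | "e = e2" | "e \<in> I - F - {e2}" using e(1) False by (auto simp: F_def)
      then show ?thesis
      proof cases
        case 3
        then have "r e = 0" using r(2) by (auto simp: supported_def)
        then show ?thesis using 1(5)[OF 3] 0 by (simp add: f_def g_def)
      qed (use ij 0 in \<open>simp_all add: f_def g_def add.assoc\<close>)
    qed
    ultimately
    show "\<exists>f g. circ f \<and> circ g \<and> supported f I \<and> supported g I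
      \<and> (\<forall>e\<in>I. even (c e + d e) \<longrightarrow> odd (a e + f e) \<or> odd (b e + g e))"
      by blast
  qed
qed

text \<open>A smallest nonempty part \<open>W\<close> of the complement with at most one edge to the
  rest of the complement sends at least two edges to \<open>U\<close>, and minimality gives the cut
  condition needed for an even subgraph through their ends in \<open>W\<close>.\<close>

lemma seymour_base_grow:
  assumes base: "seymour_base U c" "U \<noteq> {}" "U \<noteq> V"
    and conn: "\<And>Z. Z \<noteq> {} \<Longrightarrow> Z \<subset> V \<Longrightarrow> 3 \<le> card (between Z (V - Z))"
  shows "\<exists>U' c'. seymour_base U' c' \<and> U \<subset> U'"
proof -
  have UV: "U \<subseteq> V" using base(1) by (simp add: seymour_base_def)
  define R where "R = V - U"
  define ok where "ok W \<longleftrightarrow> W \<noteq> {} \<and> W \<subseteq> R \<and> card (between W (R - W)) \<le> 1" for W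
  have "ok R" using base(3) UV by (auto simp: ok_def R_def between_def)
  from ex_has_least_nat[of ok, OF this, of card]
  obtain W where W: "ok W" and min: "\<And>W'. ok W' \<Longrightarrow> card W \<le> card W'" by blast
  have WR: "W \<noteq> {}" "W \<subseteq> R" using W by (auto simp: ok_def)
  have "W \<subseteq> V" using WR(2) by (auto simp: R_def)
  have finW: "finite W" using \<open>W \<subseteq> V\<close> finite_V by (rule finite_subset)
  have "V - W = U \<union> (R - W)" using WR(2) UV by (auto simp: R_def)
  then have "card (between W (V - W)) = card (between W U) + card (between W (R - W))"
    using WR(2) by (simp only:) (rule card_between_Un, auto simp: R_def)
  moreover have "W \<subset> V" using WR(2) base(2) UV by (auto simp: R_def)
  ultimately have "2 \<le> card (between W U)" using conn[of W] W by (auto simp: ok_def)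
  then obtain e1 e2 where e12: "e1 \<in> between W U" "e2 \<in> between W U" "e1 \<noteq> e2"
    using card_le_Suc0_iff_eq[of "between W U"] finite_E by (auto simp: between_def)
  obtain x where x: "x \<in> W" "\<And>X. x \<in> X \<Longrightarrow> e1 \<in> between X U"
    using e12(1) by (auto simp: between_def)
  obtain y where y: "y \<in> W" "\<And>X. y \<in> X \<Longrightarrow> e2 \<in> between X U"
    using e12(2) by (auto simp: between_def)
  \<comment> \<open>By minimality \<open>Z\<close> and \<open>W - Z\<close> each send at least two
    edges to the rest of \<open>R\<close>. At most one of these edges leaves \<open>W\<close>, so
    twice the cut is at least 3.\<close>
  have cutW: "2 \<le> card (between Z (W - Z))" if Z: "Z \<subseteq> W" "x \<in> Z" "y \<notin> Z" for Z
  proof -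
    have big: "2 \<le> card (between Y (R - Y))" if "Y \<noteq> {}" "Y \<subset> W" for Y
    proof (rule ccontr)
      assume "\<not> ?thesis"
      then have "ok Y" using that WR(2) by (auto simp: ok_def)
      then show False using min[of Y] psubset_card_mono[OF finW that(2)] by simp
    qed
    have 1: "card (between Z (R - Z)) = card (between Z (W - Z)) + card (between Z (R - W))"
    proof -
      have "R - Z = (W - Z) \<union> (R - W)" using Z WR by blast
      then show ?thesis using Z by (simp only:) (rule card_between_Un, auto)
    qed
    have 2: "card (between (W - Z) (R - (W - Z)))
        = card (between (W - Z) Z) + card (between (W - Z) (R - W))"
    proof -
      have "R - (W - Z) = Z \<union> (R - W)" using Z WR by blast
      then show ?thesis using Z by (simp only:) (rule card_between_Un, auto)
    qed
    have 3: "card (between (R - W) W) = card (between (R - W) Z) + card (between (R - W) (W - Z))"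
    proof -
      have "W = Z \<union> (W - Z)" using Z by blast
      then show ?thesis using Z card_between_Un[of "R - W" Z "W - Z"] by auto
    qed
    have "Z \<noteq> {}" "Z \<subset> W" "W - Z \<noteq> {}" "W - Z \<subset> W" using Z x(1) y(1) by blast+
    from big[OF this(1,2)] big[OF this(3,4)]
    have "2 \<le> card (between Z (R - Z))" "2 \<le> card (between (W - Z) (R - (W - Z)))" .
    moreover have "card (between W (R - W)) \<le> 1" using W by (simp add: ok_def)
    ultimately show ?thesis
      using 1 2 3 by (simp add: between_commute[of "W - Z" Z] between_commute[of "R - W"])
  qed
  obtain X d where X: "X \<subseteq> W" "x \<in> X" "y \<in> X"
    "circ d" "supported d (induced X)" "\<forall>v\<in>X. linked {e \<in> induced X. odd (d e)} x v"
    by (rule eulerian_through_two[OF \<open>W \<subseteq> V\<close> x(1) y(1) cutW])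
  have "seymour_base (U \<union> X) (\<lambda>e. c e + d e)"
  proof (rule seymour_base_extend[OF base(1) _ x(2)[OF X(2)] y(2)[OF X(3)] e12(3) X(4,5)])
    show "X \<subseteq> V - U" using X(1) WR(2) by (auto simp: R_def)
    show "linked {e \<in> induced X. odd (d e)} u v" if "u \<in> X" "v \<in> X" for u v
      using X(6) that linked_sym linked_trans by blast
  qed
  moreover have "U \<subset> U \<union> X" using X(1,2) WR(2) by (auto simp: R_def)
  ultimately show ?thesis by blast
qed

text \<open>A largest nonempty set with \<open>seymour_base\<close> is all of \<open>V\<close>,
  since any smaller one can grow.\<close>

lemma eight_flow:
  assumes conn: "\<And>Z. Z \<noteq> {} \<Longrightarrow> Z \<subset> V \<Longrightarrow> 3 \<le> card (between Z (V - Z))"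
  obtains f1 f2 f3 where "circ f1" "circ f2" "circ f3"
    "\<And>e. e \<in> E \<Longrightarrow> odd (f1 e) \<or> odd (f2 e) \<or> odd (f3 e)"
proof (cases "V = {}")
  case True
  then show ?thesis using that[OF circ_zero circ_zero circ_zero] src_V by auto
next
  case False
  define ok where "ok U \<longleftrightarrow> U \<noteq> {} \<and> (\<exists>c. seymour_base U c)" for U
  have bound: "\<forall>U. ok U \<longrightarrow> card U \<le> card V"
    using finite_V by (auto simp: ok_def seymour_base_def intro: card_mono)
  obtain v where "v \<in> V" using False by blast
  then have "ok {v}" using seymour_base_singleton by (auto simp: ok_def)
  from ex_has_greatest_nat[of ok, OF this, of card "Suc (card V)"] bound
  obtain U where U: "ok U" "\<And>U'. ok U' \<Longrightarrow> card U' \<le> card U" by (auto simp: less_Suc_eq_le)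
  then obtain c where c: "seymour_base U c" "U \<noteq> {}" by (auto simp: ok_def)
  have "U = V"
  proof (rule ccontr)
    assume "U \<noteq> V"
    then obtain U' c' where U': "seymour_base U' c'" "U \<subset> U'"
      using seymour_base_grow[OF c _ conn] by blast
    then have "finite U'" using finite_V by (auto simp: seymour_base_def intro: finite_subset)
    moreover have "ok U'" using U' by (auto simp: ok_def)
    ultimately show False using psubset_card_mono[OF _ U'(2)] U(2) by (meson linorder_not_less)
  qed
  moreover have "induced V = E" using src_V tgt_V by (auto simp: induced_def)
  ultimately have c': "circ c" "\<forall>a b. \<exists>f g. circ f \<and> circ g
      \<and> (\<forall>e\<in>E. even (c e) \<longrightarrow> odd (a e + f e) \<or> odd (b e + g e))"
    using c(1) unfolding seymour_base_def by metis+
  \<comment> \<open>Forbidding the zero value makes \<open>f\<close> or \<open>g\<close> odd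
    wherever \<open>c\<close> is even.\<close>
  from c'(2)[rule_format, of "\<lambda>_. 0" "\<lambda>_. 0"] show ?thesis using that[OF c'(1)] by auto
qed

section \<open>Seven nowhere-zero integer flows\<close>

text \<open>\<open>h1 + 2 h2 + 4 h3\<close> vanishes nowhere since the lowest odd \<open>hi\<close> determines its 2-adic valuation.\<close>

lemma nowhere_zero_flow:
  assumes "circ f1" "circ f2" "circ f3"
    and "\<And>e. e \<in> E \<Longrightarrow> odd (f1 e) \<or> odd (f2 e) \<or> odd (f3 e)"
  obtains \<phi> where "circ \<phi>" "\<And>e. e \<in> E \<Longrightarrow> \<phi> e \<noteq> 0"
    "\<And>e. e \<in> E \<Longrightarrow> even (f2 e) \<Longrightarrow> even (f3 e) \<Longrightarrow> \<bar>\<phi> e\<bar> = 1"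
proof -
  obtain h1 where h1: "circ h1" "\<And>e. e \<in> E \<Longrightarrow> h1 e \<in> {-1, 0, 1}"
    "\<And>e. e \<in> E \<Longrightarrow> odd (h1 e) \<longleftrightarrow> odd (f1 e)" using eulerian_lift[OF assms(1)] by blast
  obtain h2 where h2: "circ h2" "\<And>e. e \<in> E \<Longrightarrow> h2 e \<in> {-1, 0, 1}"
    "\<And>e. e \<in> E \<Longrightarrow> odd (h2 e) \<longleftrightarrow> odd (f2 e)" using eulerian_lift[OF assms(2)] by blast
  obtain h3 where h3: "circ h3" "\<And>e. e \<in> E \<Longrightarrow> h3 e \<in> {-1, 0, 1}"
    "\<And>e. e \<in> E \<Longrightarrow> odd (h3 e) \<longleftrightarrow> odd (f3 e)" using eulerian_lift[OF assms(3)] by blast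
  define \<phi> where "\<phi> = (\<lambda>e. h1 e + (2 * h2 e + 4 * h3 e))"
  have "circ \<phi>" unfolding \<phi>_def using h1(1) h2(1) h3(1) by (intro circ_add circ_scale)
  moreover have "\<phi> e \<noteq> 0" if "e \<in> E" for e
    using h1(2,3)[OF that] h2(2,3)[OF that] h3(2,3)[OF that] assms(4)[OF that]
    by (auto simp: \<phi>_def)
  moreover have "\<bar>\<phi> e\<bar> = 1" if "e \<in> E" "even (f2 e)" "even (f3 e)" for e
    using h1(2,3)[OF that(1)] h2(2,3)[OF that(1)] h3(2,3)[OF that(1)] assms(4)[OF that(1)] that(2,3)
    by (auto simp: \<phi>_def)
  ultimately show ?thesis using that by blast
qed

text \<open>
  If only \<open>e\<close> left \<open>X\<close>, the at least two other edges of the cut would bring in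
  more than the single unit that \<open>e\<close> takes out.
\<close>

lemma unit_edge_not_needed:
  assumes "circ \<phi>" "\<And>a. a \<in> E \<Longrightarrow> \<phi> a \<noteq> 0" "e \<in> E" "\<bar>\<phi> e\<bar> = 1"
    and "X \<subseteq> V" "3 \<le> card (between X (V - X))"
  shows "\<exists>a\<in>E - {e}. \<phi> a > 0 \<and> src a \<in> X \<and> tgt a \<notin> X \<or> \<phi> a < 0 \<and> tgt a \<in> X \<and> src a \<notin> X"
proof (rule ccontr)
  assume no: "\<not> ?thesis"
  define t where "t a = \<phi> a * (of_bool (src a \<in> X) - of_bool (tgt a \<in> X))" for a
  define C where "C = between X (V - X)"
  have "finite X" using assms(5) finite_V finite_subset by blast
  then have "0 = (\<Sum>a\<in>E. t a)"
    using assms(1) sum_bd[of X \<phi>] by (simp add: circ_def t_def)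
  also have "\<dots> = t e + (\<Sum>a\<in>E - {e}. t a)" using finite_E assms(3) by (simp add: sum.remove)
  also have "\<dots> \<le> 1 + (\<Sum>a\<in>E - {e}. - of_bool (a \<in> C))"
  proof (intro add_mono sum_mono)
    show "t e \<le> 1" using assms(4) by (auto simp: t_def)
    fix a assume a: "a \<in> E - {e}"
    then have "\<not> (\<phi> a > 0 \<and> src a \<in> X \<and> tgt a \<notin> X)" "\<not> (\<phi> a < 0 \<and> tgt a \<in> X \<and> src a \<notin> X)"
      "\<phi> a \<noteq> 0" using no assms(2) by blast+
    then show "t a \<le> - of_bool (a \<in> C)"
      by (cases "src a \<in> X"; cases "tgt a \<in> X") (auto simp: t_def C_def between_def)
  qed
  also have "(\<Sum>a\<in>E - {e}. - of_bool (a \<in> C)) = - int (card (C - {e}))"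
  proof -
    have "(E - {e}) \<inter> C = C - {e}" by (auto simp: C_def between_def)
    then show ?thesis using finite_E by (simp add: sum_negf of_bool_def sum.If_cases)
  qed
  finally have "card (C - {e}) \<le> 1" by simp
  moreover have "card C \<le> Suc (card (C - {e}))"
    using card_Diff1_le[of C e] by (cases "e \<in> C") (auto simp: card_Suc_Diff1 C_def between_def finite_E)
  ultimately show False using assms(6) by (simp add: C_def)
qed

text \<open>One flow for each nonzero element of \<open>\<int>\<^sub>2\<^sup>3\<close>, the value of an edge under the 8-flow.\<close>

lemma seven_flows:
  assumes conn: "\<And>Z. Z \<noteq> {} \<Longrightarrow> Z \<subset> V \<Longrightarrow> 3 \<le> card (between Z (V - Z))"
  obtains \<phi> :: "nat \<Rightarrow> 'e \<Rightarrow> int" where "\<And>i. circ (\<phi> i)" "\<And>i e. e \<in> E \<Longrightarrow> \<phi> i e \<noteq> 0"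
    "\<And>e. e \<in> E \<Longrightarrow> \<exists>i<7. \<bar>\<phi> i e\<bar> = 1"
proof -
  obtain f1 f2 f3 where f: "circ f1" "circ f2" "circ f3"
    and odd: "\<And>e. e \<in> E \<Longrightarrow> odd (f1 e) \<or> odd (f2 e) \<or> odd (f3 e)"
    using eight_flow[OF conn] by blast
  let ?f12 = "\<lambda>e. f1 e + f2 e" and ?f13 = "\<lambda>e. f1 e + f3 e" and ?f23 = "\<lambda>e. f2 e + f3 e"
  \<comment> \<open>Each triple is a change of basis modulo 2; evenness of its last two entries
    singles out one of the seven nonzero values.\<close>
  define F :: "(('e \<Rightarrow> int) \<times> ('e \<Rightarrow> int) \<times> ('e \<Rightarrow> int)) list" where
    "F = [(f1, f2, f3), (f2, f1, f3), (f3, f1, f2), (f1, ?f12, f3), (f1, ?f13, f2),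
      (f2, ?f23, f1), (f1, ?f12, ?f13)]"
  have "length F = 7" by (simp add: F_def)
  have "\<exists>\<phi>. circ \<phi> \<and> (\<forall>e\<in>E. \<phi> e \<noteq> 0 \<and> (even (g2 e) \<and> even (g3 e) \<longrightarrow> \<bar>\<phi> e\<bar> = 1))"
    if "(g1, g2, g3) \<in> set F" for g1 g2 g3
  proof -
    have "circ g1" "circ g2" "circ g3"
      using that f circ_add by (auto simp: F_def)
    moreover have "odd (g1 e) \<or> odd (g2 e) \<or> odd (g3 e)" if "e \<in> E" for e
      using \<open>(g1, g2, g3) \<in> set F\<close> odd[OF that] by (auto simp: F_def)
    ultimately show ?thesis using nowhere_zero_flow[of g1 g2 g3] by metis
  qed
  then have "\<forall>i. \<exists>\<phi>. i < 7 \<longrightarrow> circ \<phi> \<and> (\<forall>e\<in>E. \<phi> e \<noteq> 0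
      \<and> (even (fst (snd (F ! i)) e) \<and> even (snd (snd (F ! i)) e) \<longrightarrow> \<bar>\<phi> e\<bar> = 1))"
    by (metis \<open>length F = 7\<close> nth_mem prod.collapse)
  then obtain \<phi> where \<phi>: "\<And>i. i < 7 \<Longrightarrow> circ (\<phi> i)" "\<And>i e. i < 7 \<Longrightarrow> e \<in> E \<Longrightarrow> \<phi> i e \<noteq> 0"
    "\<And>i e. i < 7 \<Longrightarrow> e \<in> E \<Longrightarrow> even (fst (snd (F ! i)) e) \<Longrightarrow> even (snd (snd (F ! i)) e) \<Longrightarrow> \<bar>\<phi> i e\<bar> = 1"
    by metis
  have "\<exists>i<7. \<bar>\<phi> i e\<bar> = 1" if e: "e \<in> E" for e
  proof -
    have "\<exists>i<7. even (fst (snd (F ! i)) e) \<and> even (snd (snd (F ! i)) e)"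
      using odd[OF e] by (simp add: F_def eval_nat_numeral All_less_Suc Ex_less_Suc) argo
    then show ?thesis using \<phi>(3) e by blast
  qed
  \<comment> \<open>Indices from 7 on repeat the flow of index 0, as the first two claims range over
    all indices.\<close>
  then show ?thesis using that[of "\<lambda>i. \<phi> (if i < 7 then i else 0)"] \<phi>(1,2) by fastforce
qed

end

section \<open>Strong orientations from the flows\<close>

theorem theorem14:
  fixes G :: "('v, 'e) ugraph"
  assumes "finite_multigraph G"
    and "cubic G"
    and "k_edge_connected 3 G"
  shows "frank_number G \<le> 7"
proof -
  have "\<exists>u v. uends G e = {u, v} \<and> u \<noteq> v \<and> u \<in> uverts G \<and> v \<in> uverts G" if "e \<in> uedges G" for e
  proof -
    have "uends G e \<subseteq> uverts G" "card (uends G e) = 2"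
      using assms(1) that by (auto simp: finite_multigraph_def)
    then show ?thesis by (auto simp: card_2_iff)
  qed
  \<comment> \<open>An arbitrary order of the two ends serves as reference orientation.\<close>
  then obtain s t where st: "\<And>e. e \<in> uedges G \<Longrightarrow> uends G e = {s e, t e} \<and> s e \<noteq> t e
      \<and> s e \<in> uverts G \<and> t e \<in> uverts G"
    by metis
  interpret multigraph "uverts G" "uedges G" s t
    using assms(1) st by unfold_locales (auto simp: finite_multigraph_def)
  have "between Z (uverts G - Z) = edge_cut G Z" if "Z \<subset> uverts G" for Z
    using st that by (fastforce simp: between_def edge_cut_def)
  then have conn: "3 \<le> card (between Z (uverts G - Z))" if "Z \<noteq> {}" "Z \<subset> uverts G" for Z
    using assms(3) that by (auto simp: k_edge_connected_def)
  obtain \<phi> :: "nat \<Rightarrow> 'e \<Rightarrow> int" where \<phi>: "\<And>i. circ (\<phi> i)"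
    "\<And>i e. e \<in> uedges G \<Longrightarrow> \<phi> i e \<noteq> 0" "\<And>e. e \<in> uedges G \<Longrightarrow> \<exists>i<7. \<bar>\<phi> i e\<bar> = 1"
    using seven_flows[OF conn] by blast
  \<comment> \<open>Arcs follow the flow; as it vanishes on no edge, the second branch covers
    exactly the edges with negative value.\<close>
  define D where "D i = \<lparr>verts = uverts G, arcs = uedges G,
    tail = (\<lambda>e. if \<phi> i e > 0 then s e else t e), head = (\<lambda>e. if \<phi> i e > 0 then t e else s e)\<rparr>" for i
  have "orientation G (D i)" for i
    using st by (auto simp: orientation_def D_def)
  moreover have "\<exists>i<7. strongly_connected (pre_digraph.del_arc (D i) e)" if e: "e \<in> uedges G" for e
  proof -
    obtain i where i: "i < 7" "\<bar>\<phi> i e\<bar> = 1" using \<phi>(3)[OF e] by blast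
    let ?D = "pre_digraph.del_arc (D i) e"
    have D: "verts ?D = uverts G" "arcs ?D = uedges G - {e}"
      "tail ?D = (\<lambda>e. if \<phi> i e > 0 then s e else t e)"
      "head ?D = (\<lambda>e. if \<phi> i e > 0 then t e else s e)"
      by (simp_all add: pre_digraph.del_arc_simps D_def)
    interpret D: wf_digraph ?D
      by unfold_locales (auto simp: D st)
    have "\<exists>a\<in>arcs ?D. tail ?D a \<in> X \<and> head ?D a \<notin> X" if X: "X \<noteq> {}" "X \<subset> verts ?D" for X
    proof -
      have "X \<subseteq> uverts G" "3 \<le> card (between X (uverts G - X))" using X conn by (auto simp: D)
      from unit_edge_not_needed[OF \<phi>(1) \<phi>(2) e i(2) this]
      obtain a where "a \<in> uedges G - {e}"
        "\<phi> i a > 0 \<and> s a \<in> X \<and> t a \<notin> X \<or> \<phi> i a < 0 \<and> t a \<in> X \<and> s a \<notin> X" by blast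
      then show ?thesis by (intro bexI[of _ a]) (auto simp: D)
    qed
    \<comment> \<open>The cut criterion assumes a vertex, and the ends of \<open>e\<close> provide
      one.\<close>
    moreover have "verts ?D \<noteq> {}" using st[OF e] by (auto simp: D)
    ultimately have "strongly_connected ?D" using D.strongly_connected_iff_cut by blast
    then show ?thesis using i(1) by blast
  qed
  ultimately have "frank_orientations G 7 D" by (auto simp: frank_orientations_def)
  then have "frank_number G \<le> enat 7" using frank_number_le_iff by blast
  then show ?thesis by (simp add: numeral_eq_enat)
qed

end
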